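(* Let $\hat\alpha=\hat\alpha_n$ be a strongly consistent estimator of $\alpha$, i.e. $\hat\alpha\xrightarrow{a.s.}\alpha$ as $n\to\infty$, and let $s_1,\dots,s_p$ be nonzero real scalars. Then, as $n\to\infty$, $$[\hat{\boldsymbol\Sigma}]_{ii}:=\frac{2}{s_i^2}\big(-\log|\hat\phi_n(s_i\mathbf{e}_i)|\big)^{2/\hat\alpha}\xrightarrow{a.s.}\boldsymbol\Sigma_{ii},\qquad i\le p,$$ $$[\hat{\boldsymbol\Sigma}]_{ij}:=\frac{\big[-\log|\hat\phi_n(\mathbf{e}_i+\mathbf{e}_j)|\big]^{2/\hat\alpha}-\big[-\log|\hat\phi_n(\mathbf{e}_i-\mathbf{e}_j)|\big]^{2/\hat\alpha}}{2}\xrightarrow{a.s.}\boldsymbol\Sigma_{ij},\qquad i\le p,\ j\le i.$$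
   Context: Let $p\ge 1$, $0<\alpha<2$, $\boldsymbol\mu\in\mathbb{R}^p$, and let $\boldsymbol\Sigma$ be a real symmetric positive semi-definite $p\times p$ matrix. The $p$-dimensional sub-Gaussian stable distribution $S_p(\boldsymbol\mu,\boldsymbol\Sigma,\alpha)$ is the law on $\mathbb{R}^p$ with characteristic function $$\phi(\mathbf{t})=\mathbb{E}[e^{i\mathbf{t}^\top\mathbf{x}}]=\exp\Big(i\mathbf{t}^\top\boldsymbol\mu-\big(\tfrac12\mathbf{t}^\top\boldsymbol\Sigma\mathbf{t}\big)^{\alpha/2}\Big),\quad \mathbf{t}\in\mathbb{R}^p.$$ Let $\mathbf{x}_1,\mathbf{x}_2,\dots$ be i.i.d. with law $S_p(\boldsymbol\mu,\boldsymbol\Sigma,\alpha)$. The empirical characteristic function is $\hat\phi_n(\mathbf{t})=\frac1n\sum_{j=1}^n e^{i\mathbf{t}^\top\mathbf{x}_j}$. Let $\mathbf{e}_i\in\mathbb{R}^p$ be the $i$-th standard basis vector. No assumption is imposed on $\boldsymbol\Sigma$ beyond symmetry and positive semi-definiteness. *)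

theory Defs
  imports "HOL-Probability.Probability"
begin

definition pos_semidef_matrix :: "real ^ 'p ^ 'p \<Rightarrow> bool" where
  "pos_semidef_matrix S \<longleftrightarrow> transpose S = S \<and> (\<forall>t. 0 \<le> t \<bullet> (S *v t))"

text \<open>The library's \<open>char\<close> is only available for measures on the real line.\<close>

definition mv_char :: "'a::euclidean_space measure \<Rightarrow> 'a \<Rightarrow> complex" where
  "mv_char N t = (CLINT x|N. iexp (t \<bullet> x))"

text \<open>
  The law \<open>S\<^sub>p(\<mu>, \<Sigma>, \<alpha>)\<close>, as a predicate on measures: a characteristic function determines
  the Borel probability measure, so at most one \<open>N\<close> satisfies it. The quadratic form may vanish,
  in which case \<open>0 powr (\<alpha>/2) = 0\<close> as required.
\<close>

definition sub_gaussian_stable ::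
    "real ^ 'p \<Rightarrow> real ^ 'p ^ 'p \<Rightarrow> real \<Rightarrow> (real ^ 'p::finite) measure \<Rightarrow> bool" where
  "sub_gaussian_stable \<mu> S \<alpha> N \<longleftrightarrow>
     prob_space N \<and> sets N = sets borel \<and>
     (\<forall>t. mv_char N t =
        exp (\<i> * of_real (t \<bullet> \<mu>) - of_real ((t \<bullet> (S *v t) / 2) powr (\<alpha> / 2))))"

text \<open>Samples are indexed from 0, so the first \<open>n\<close> observations are \<open>X 0, \<dots>, X (n - 1)\<close>.\<close>

definition iid_sample ::
    "'w measure \<Rightarrow> (nat \<Rightarrow> 'w \<Rightarrow> 'a::topological_space) \<Rightarrow> 'a measure \<Rightarrow> bool" where
  "iid_sample M X N \<longleftrightarrow>
     prob_space.indep_vars M (\<lambda>_. borel) X UNIV \<and> (\<forall>j. distr M borel (X j) = N)"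

definition emp_char ::
    "(nat \<Rightarrow> 'w \<Rightarrow> 'a::euclidean_space) \<Rightarrow> nat \<Rightarrow> 'w \<Rightarrow> 'a \<Rightarrow> complex" where
  "emp_char X n \<omega> t = (1 / of_nat n) * (\<Sum>j<n. iexp (t \<bullet> X j \<omega>))"

text \<open>An estimator is a measurable function of the first \<open>n\<close> observations.\<close>

definition strongly_consistent_estimator ::
    "'w measure \<Rightarrow> (nat \<Rightarrow> 'w \<Rightarrow> 'a::topological_space) \<Rightarrow> (nat \<Rightarrow> 'w \<Rightarrow> real) \<Rightarrow> real \<Rightarrow> bool" where
  "strongly_consistent_estimator M X a \<theta> \<longleftrightarrow>
     (\<forall>n. \<exists>T \<in> borel_measurable (Pi\<^sub>M {..<n} (\<lambda>_. borel :: 'a measure)).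
        \<forall>\<omega>\<in>space M. a n \<omega> = T (\<lambda>j\<in>{..<n}. X j \<omega>)) \<and>
     (AE \<omega> in M. (\<lambda>n. a n \<omega>) \<longlonglongrightarrow> \<theta>)"

text \<open>
  The two estimators of the entries of \<open>\<Sigma>\<close>. The bases \<open>- ln |emp_char \<dots>|\<close> are nonnegative
  for \<open>n > 0\<close>. For \<open>i = j\<close> the subtracted term of \<open>Sigma_hat_offdiag\<close> is \<open>0 powr \<dots> = 0\<close>.
\<close>

definition Sigma_hat_diag ::
    "(nat \<Rightarrow> 'w \<Rightarrow> real ^ 'p::finite) \<Rightarrow> (nat \<Rightarrow> 'w \<Rightarrow> real) \<Rightarrow> ('p \<Rightarrow> real) \<Rightarrow> nat \<Rightarrow> 'w \<Rightarrow> 'p \<Rightarrow> real" where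
  "Sigma_hat_diag X a s n \<omega> i =
     2 / (s i)\<^sup>2 * (- ln (cmod (emp_char X n \<omega> (s i *\<^sub>R axis i 1)))) powr (2 / a n \<omega>)"

definition Sigma_hat_offdiag ::
    "(nat \<Rightarrow> 'w \<Rightarrow> real ^ 'p::finite) \<Rightarrow> (nat \<Rightarrow> 'w \<Rightarrow> real) \<Rightarrow> nat \<Rightarrow> 'w \<Rightarrow> 'p \<Rightarrow> 'p \<Rightarrow> real" where
  "Sigma_hat_offdiag X a n \<omega> i j =
     ((- ln (cmod (emp_char X n \<omega> (axis i 1 + axis j 1)))) powr (2 / a n \<omega>)
      - (- ln (cmod (emp_char X n \<omega> (axis i 1 - axis j 1)))) powr (2 / a n \<omega>)) / 2"

end

theory Submission
  imports Defs
begin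

text \<open>
  For fixed \<open>t\<close> the summands \<open>e\<^bsup>i t\<bullet>X\<^sub>j\<^esup>\<close> of the empirical characteristic function are i.i.d. and
  bounded, so a strong law of large numbers for bounded variables
  (\<open>bounded_strong_law\<close>) gives almost sure convergence to the characteristic function
  (\<open>emp_char_tendsto_mv_char\<close>). Boundedness makes the strong law cheap: Hoeffding's inequality
  yields exponentially small, hence summable, deviation probabilities, and Borel-Cantelli finishes.

  The location \<open>\<mu>\<close> only contributes a phase, so the modulus of the limit is
  \<open>exp (- q powr (\<alpha>/2))\<close> with \<open>q = t \<bullet> \<Sigma>t / 2\<close>, and the map
  \<open>(z, a) \<mapsto> (- ln \<bar>z\<bar>) powr (2/a)\<close> recovers \<open>q\<close> continuously
  (\<open>neg_ln_cmod_powr_tendsto\<close>). The only delicate case is \<open>q = 0\<close>, which a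
  singular \<open>\<Sigma>\<close> allows: there \<open>powr\<close> is evaluated near base \<open>0\<close>, and continuity holds because the
  exponent tends to \<open>2/\<alpha> > 0\<close> and the base stays nonnegative, an average of unit complex
  numbers having modulus at most \<open>1\<close>. The diagonal entries are then read off from
  \<open>t = s\<^sub>i e\<^sub>i\<close>, and the other entries from \<open>t = e\<^sub>i \<plusminus> e\<^sub>j\<close> by polarization.
\<close>

text \<open>
  By Hoeffding's inequality the probability that the average of the first \<open>n\<close> variables misses
  \<open>m\<close> by at least \<open>\<epsilon>\<close> is bounded by a geometric sequence in \<open>n\<close>. By Borel-Cantelli such a
  deviation almost surely occurs only finitely often, and it suffices to treat the countably
  many values \<open>\<epsilon> = 1/(k+1)\<close>.
\<close>

lemma (in prob_space) bounded_strong_law: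
  fixes X :: "nat \<Rightarrow> 'a \<Rightarrow> real"
  assumes indep: "indep_vars (\<lambda>_. borel) X UNIV"
    and bounds: "\<And>j. AE x in M. X j x \<in> {a..b}" and "a < b"
    and mean: "\<And>j. expectation (X j) = m"
  shows "AE x in M. (\<lambda>n. (\<Sum>j<n. X j x) / n) \<longlonglongrightarrow> m"
proof -
  have [measurable]: "X j \<in> borel_measurable M" for j
    using indep unfolding indep_vars_def by auto
  have deviation: "AE x in M. eventually (\<lambda>n. \<bar>(\<Sum>j<n. X j x) / n - m\<bar> < \<epsilon>) sequentially"
    if "\<epsilon> > 0" for \<epsilon> :: real
  proof -
    define A where "A n = {x \<in> space M. \<bar>(\<Sum>j<n. X j x) / n - m\<bar> \<ge> \<epsilon>}" for n
    define r where "r = exp (- 2 * \<epsilon>\<^sup>2 / (b - a)\<^sup>2)"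
    have [measurable]: "A n \<in> sets M" for n
      unfolding A_def by measurable
    have "r < 1"
      using \<open>\<epsilon> > 0\<close> \<open>a < b\<close> by (simp add: r_def)
    have bound: "prob (A n) \<le> 2 * r ^ n" if "n \<ge> 1" for n
    proof -
      interpret Hoeffding_ineq M "{..<n}" X "\<lambda>_. a" "\<lambda>_. b" "n * m"
        using indep_vars_subset[OF indep] bounds by unfold_locales (auto simp: mean)
      have "A n = {x \<in> space M. \<bar>(\<Sum>j<n. X j x) - n * m\<bar> \<ge> n * \<epsilon>}"
      proof -
        have "\<bar>c / n - m\<bar> \<ge> \<epsilon> \<longleftrightarrow> \<bar>c - n * m\<bar> \<ge> n * \<epsilon>" for c
        proof -
          have "c - n * m = n * (c / n - m)"
            using that by (simp add: field_simps)
          then show ?thesis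
            using that by (simp add: abs_mult)
        qed
        then show ?thesis
          by (simp add: A_def)
      qed
      also have "prob \<dots> \<le> 2 * exp (- 2 * (n * \<epsilon>)\<^sup>2 / (\<Sum>j<n. (b - a)\<^sup>2))"
        using that \<open>\<epsilon> > 0\<close> \<open>a < b\<close> by (intro Hoeffding_ineq_abs_ge) auto
      also have "- 2 * (n * \<epsilon>)\<^sup>2 / (\<Sum>j<n. (b - a)\<^sup>2) = n * (- 2 * \<epsilon>\<^sup>2 / (b - a)\<^sup>2)"
        using that by (simp add: power2_eq_square)
      finally show ?thesis
        by (simp only: r_def exp_of_nat_mult)
    qed
    have "summable (\<lambda>n. prob (A n))"
    proof (rule summable_comparison_test')
      show "summable (\<lambda>n. 2 * r ^ n)"
        using \<open>r < 1\<close> by (intro summable_mult summable_geometric) (simp add: r_def)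
    qed (use bound in auto)
    then have "AE x in M. eventually (\<lambda>n. x \<in> space M - A n) sequentially"
      by (intro borel_cantelli_AE1) (auto simp: emeasure_eq_measure)
    then show ?thesis
      by (rule AE_mp) (auto simp: A_def not_le elim!: eventually_mono)
  qed
  have "AE x in M. \<forall>k. eventually (\<lambda>n. \<bar>(\<Sum>j<n. X j x) / n - m\<bar> < inverse (real (Suc k)))
          sequentially"
    unfolding AE_all_countable by (intro allI deviation) simp
  then show ?thesis
  proof (rule AE_mp, intro AE_I2 impI)
    fix x assume ev: "\<forall>k. eventually (\<lambda>n. \<bar>(\<Sum>j<n. X j x) / n - m\<bar> < inverse (real (Suc k)))
          sequentially"
    show "(\<lambda>n. (\<Sum>j<n. X j x) / n) \<longlonglongrightarrow> m"
    proof (rule tendstoI)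
      fix e :: real assume "e > 0"
      then obtain k where k: "inverse (real (Suc k)) < e"
        using reals_Archimedean by blast
      show "eventually (\<lambda>n. dist ((\<Sum>j<n. X j x) / n) m < e) sequentially"
        using ev[rule_format, of k] by eventually_elim (use k in \<open>simp add: dist_real_def\<close>)
    qed
  qed
qed

text \<open>The strong law is applied to the real and imaginary parts, both of which lie in \<open>[-1, 1]\<close>.\<close>

lemma emp_char_tendsto_mv_char:
  fixes X :: "nat \<Rightarrow> 'w \<Rightarrow> 'a::euclidean_space"
  assumes "prob_space M" and iid: "iid_sample M X N"
  shows "AE \<omega> in M. (\<lambda>n. emp_char X n \<omega> t) \<longlonglongrightarrow> mv_char N t"
proof -
  interpret prob_space M by fact
  have indep: "indep_vars (\<lambda>_. borel) X UNIV" and distr: "distr M borel (X j) = N" for j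
    using iid by (auto simp: iid_sample_def)
  have [measurable]: "X j \<in> borel_measurable M" for j
    using indep unfolding indep_vars_def by auto
  let ?e = "\<lambda>x. iexp (t \<bullet> x)"
  have int: "integrable M (\<lambda>\<omega>. ?e (X j \<omega>))" for j
    by (rule integrable_const_bound[of _ 1]) auto
  have mean: "(CLINT \<omega>|M. ?e (X j \<omega>)) = mv_char N t" for j
    unfolding mv_char_def distr[of j, symmetric] by (rule integral_distr[symmetric]) measurable
  have law: "AE \<omega> in M. (\<lambda>n. (\<Sum>j<n. g (?e (X j \<omega>))) / n) \<longlonglongrightarrow> g (mv_char N t)"
    if "bounded_linear g" and g: "\<And>z. \<bar>g z\<bar> \<le> cmod z" for g :: "complex \<Rightarrow> real"
  proof (rule bounded_strong_law[where a = "-1" and b = 1])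
    have [measurable]: "g \<in> borel_measurable borel"
      using \<open>bounded_linear g\<close>
      by (intro borel_measurable_continuous_onI linear_continuous_on)
    show "indep_vars (\<lambda>_. borel) (\<lambda>j \<omega>. g (?e (X j \<omega>))) UNIV"
      by (rule indep_vars_compose2[OF indep]) measurable
    show "AE \<omega> in M. g (?e (X j \<omega>)) \<in> {-1..1}" for j
    proof (rule AE_I2)
      fix \<omega>
      show "g (?e (X j \<omega>)) \<in> {-1..1}"
        using g[of "?e (X j \<omega>)"] by (simp add: abs_le_iff)
    qed
    show "expectation (\<lambda>\<omega>. g (?e (X j \<omega>))) = g (mv_char N t)" for j
      using integral_bounded_linear[OF \<open>bounded_linear g\<close> int[of j]] by (simp only: mean)
  qed simp
  have "AE \<omega> in M. (\<lambda>n. (\<Sum>j<n. Re (?e (X j \<omega>))) / n) \<longlonglongrightarrow> Re (mv_char N t)"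
    and "AE \<omega> in M. (\<lambda>n. (\<Sum>j<n. Im (?e (X j \<omega>))) / n) \<longlonglongrightarrow> Im (mv_char N t)"
    by (intro law bounded_linear_Re bounded_linear_Im abs_Re_le_cmod abs_Im_le_cmod)+
  then show ?thesis
  proof eventually_elim
    case (elim \<omega>)
    have "emp_char X n \<omega> t =
        Complex ((\<Sum>j<n. Re (?e (X j \<omega>))) / n) ((\<Sum>j<n. Im (?e (X j \<omega>))) / n)" for n
      by (simp add: emp_char_def complex_eq_iff Re_divide_of_nat Im_divide_of_nat)
    then show ?case
      using tendsto_Complex[OF elim] by simp
  qed
qed

lemma cmod_emp_char_le_1: "cmod (emp_char X n \<omega> t) \<le> 1"
proof -
  have "cmod (\<Sum>j<n. iexp (t \<bullet> X j \<omega>)) \<le> (\<Sum>j<n. 1)"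
    by (rule sum_norm_le) simp
  then show ?thesis
    by (cases "n = 0") (simp_all add: emp_char_def norm_mult norm_divide)
qed

text \<open>
  At \<open>q = 0\<close> continuity of \<open>powr\<close> requires the nonnegative base that \<open>cmod (z n) \<le> 1\<close> provides.
\<close>

lemma neg_ln_cmod_powr_tendsto:
  fixes z :: "nat \<Rightarrow> complex" and a :: "nat \<Rightarrow> real"
  assumes z: "z \<longlonglongrightarrow> w" and a: "a \<longlonglongrightarrow> \<alpha>" and "\<alpha> > 0" and "q \<ge> 0"
    and w: "cmod w = exp (- (q powr (\<alpha> / 2)))" and le1: "\<And>n. cmod (z n) \<le> 1"
  shows "(\<lambda>n. (- ln (cmod (z n))) powr (2 / a n)) \<longlonglongrightarrow> q"
proof -
  have "(\<lambda>n. - ln (cmod (z n))) \<longlonglongrightarrow> - ln (cmod w)"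
    by (intro tendsto_intros z) (simp add: w)
  then have base: "(\<lambda>n. - ln (cmod (z n))) \<longlonglongrightarrow> q powr (\<alpha> / 2)"
    by (simp add: w)
  have expo: "(\<lambda>n. 2 / a n) \<longlonglongrightarrow> 2 / \<alpha>"
    using \<open>\<alpha> > 0\<close> by (intro tendsto_intros a) simp
  \<comment> \<open>The value \<open>ln 0 = 0\<close> keeps the base nonnegative also where \<open>z n\<close> vanishes.\<close>
  have "- ln (cmod (z n)) \<ge> 0" for n
    using le1[of n] by (cases "z n = 0") auto
  then have "(\<lambda>n. (- ln (cmod (z n))) powr (2 / a n)) \<longlonglongrightarrow> (q powr (\<alpha> / 2)) powr (2 / \<alpha>)"
    using \<open>\<alpha> > 0\<close> by (intro tendsto_powr' base expo) auto
  also have "(q powr (\<alpha> / 2)) powr (2 / \<alpha>) = q"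
    using \<open>\<alpha> > 0\<close> \<open>q \<ge> 0\<close> by (simp add: powr_powr)
  finally show ?thesis .
qed

text \<open>The common core of both estimators: every value of the quadratic form is estimated consistently.\<close>

lemma quadratic_form_estimator_tendsto:
  fixes X :: "nat \<Rightarrow> 'w \<Rightarrow> real ^ 'p::finite"
  assumes "prob_space M" and "\<alpha> > 0" and "pos_semidef_matrix S"
    and N: "sub_gaussian_stable \<mu> S \<alpha> N" and "iid_sample M X N"
    and a: "AE \<omega> in M. (\<lambda>n. a n \<omega>) \<longlonglongrightarrow> \<alpha>"
  shows "AE \<omega> in M. (\<lambda>n. (- ln (cmod (emp_char X n \<omega> t))) powr (2 / a n \<omega>))
           \<longlonglongrightarrow> t \<bullet> (S *v t) / 2"
proof -
  have modulus: "cmod (mv_char N t) = exp (- ((t \<bullet> (S *v t) / 2) powr (\<alpha> / 2)))"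
    using N by (simp add: sub_gaussian_stable_def)
  have nonneg: "t \<bullet> (S *v t) / 2 \<ge> 0"
    using \<open>pos_semidef_matrix S\<close> by (simp add: pos_semidef_matrix_def)
  show ?thesis
    using emp_char_tendsto_mv_char[OF \<open>prob_space M\<close> \<open>iid_sample M X N\<close>, of t] a
    by eventually_elim
      (rule neg_ln_cmod_powr_tendsto[OF _ _ \<open>\<alpha> > 0\<close> nonneg modulus cmod_emp_char_le_1])
qed

lemma axis_quadratic_form:
  fixes S :: "real ^ 'p::finite ^ 'p"
  shows "axis i 1 \<bullet> (S *v axis j 1) = S $ i $ j"
  by (simp add: inner_axis' matrix_vector_mul_component inner_axis)

theorem proposition2p3:
  fixes M :: "'w measure"
    and X :: "nat \<Rightarrow> 'w \<Rightarrow> real ^ ('p :: {finite, linorder})"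
    and N :: "(real ^ ('p :: {finite, linorder})) measure"
    and \<mu> :: "real ^ ('p :: {finite, linorder})"
    and S :: "real ^ ('p :: {finite, linorder}) ^ ('p :: {finite, linorder})"
    and \<alpha> :: real
    and alpha_hat :: "nat \<Rightarrow> 'w \<Rightarrow> real"
    and s :: "'p :: {finite, linorder} \<Rightarrow> real"
  assumes "prob_space M"
    and "0 < \<alpha>" and "\<alpha> < 2"
    and "pos_semidef_matrix S"
    and "sub_gaussian_stable \<mu> S \<alpha> N"
    and "iid_sample M X N"
    and "strongly_consistent_estimator M X alpha_hat \<alpha>"
    and "\<And>i. s i \<noteq> 0"
  shows "(\<forall>i. AE \<omega> in M. (\<lambda>n. Sigma_hat_diag X alpha_hat s n \<omega> i) \<longlonglongrightarrow> S $ i $ i) \<and>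
         (\<forall>i j. j \<le> i \<longrightarrow>
            (AE \<omega> in M. (\<lambda>n. Sigma_hat_offdiag X alpha_hat n \<omega> i j) \<longlonglongrightarrow> S $ i $ j))"
proof (intro conjI allI impI)
  have cons: "AE \<omega> in M. (\<lambda>n. alpha_hat n \<omega>) \<longlonglongrightarrow> \<alpha>"
    using assms(7) by (simp add: strongly_consistent_estimator_def)
  note lim = quadratic_form_estimator_tendsto[OF assms(1,2,4,5,6) cons]
  fix i j :: 'p
  have scaled: "2 / (s i)\<^sup>2 * ((s i *\<^sub>R axis i 1) \<bullet> (S *v (s i *\<^sub>R axis i 1)) / 2) = S $ i $ i"
    using assms(8)[of i]
    by (simp add: matrix_vector_mult_scaleR axis_quadratic_form power2_eq_square)
  show "AE \<omega> in M. (\<lambda>n. Sigma_hat_diag X alpha_hat s n \<omega> i) \<longlonglongrightarrow> S $ i $ i"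
    using lim[of "s i *\<^sub>R axis i 1"]
  proof eventually_elim
    case (elim \<omega>)
    show ?case
      using tendsto_mult_left[OF elim, of "2 / (s i)\<^sup>2"]
      unfolding Sigma_hat_diag_def scaled .
  qed
  have "transpose S $ j $ i = S $ i $ j"
    by (simp add: transpose_def)
  then have "S $ j $ i = S $ i $ j"
    using assms(4) by (simp add: pos_semidef_matrix_def)
  then have polarization: "((axis i 1 + axis j 1) \<bullet> (S *v (axis i 1 + axis j 1)) / 2
      - (axis i 1 - axis j 1) \<bullet> (S *v (axis i 1 - axis j 1)) / 2) / 2 = S $ i $ j"
    by (simp add: matrix_vector_right_distrib matrix_vector_mult_diff_distrib inner_simps
        axis_quadratic_form field_simps)
  show "AE \<omega> in M. (\<lambda>n. Sigma_hat_offdiag X alpha_hat n \<omega> i j) \<longlonglongrightarrow> S $ i $ j"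
    using lim[of "axis i 1 + axis j 1"] lim[of "axis i 1 - axis j 1"]
  proof eventually_elim
    case (elim \<omega>)
    show ?case
      using tendsto_divide[OF tendsto_diff[OF elim] tendsto_const, of 2]
      unfolding Sigma_hat_offdiag_def polarization by simp
  qed
qed

end
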